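(* Let $X,Y$ be finite skew braces and let $f:X\to Y$ be an epimorphism of skew braces. Then $$f\bigl(L_\infty(X)\bigr)=L_\infty(Y)\qquad\text{and}\qquad f(\mathfrak{R}_L(X))=\mathfrak{R}_L(Y).$$ Consequently, if $I$ is an ideal of $X$, then $\mathfrak{R}_L(X/I)=(\mathfrak{R}_L(X)+I)/I$. Both $L_\infty(X)$ and $\mathfrak{R}_L(X)$ are invariant under every skew brace automorphism of $X$.
   Context: A skew (left) brace is a triple $X=(X,+,\cdot)$ such that $(X,+)$ and $(X,\cdot)$ are groups on the same set and $a\cdot(b+c)=a\cdot b-a+a\cdot c$ for all $a,b,c\in X$. Put $\lambda_a(b)=-a+a\cdot b$ and $a*b=\lambda_a(b)-b$; for subsets $S,T$, $S*T$ is the subgroup of $(X,+)$ generated by all $s*t$, $s\in S$, $t\in T$. An ideal of $X$ is a subgroup of $(X,+)$ that is invariant under every $\lambda_a$ and normal in both $(X,+)$ and $(X,\cdot)$. The left series is $X^1=X$, $X^{n+1}=X*X^n$; $X$ is left nilpotent if $X^n=0$ for some $n$; $L_\infty(X)=\bigcap_{n\ge1}X^n$. The left-nilpotent residual $\mathfrak{R}_L(X)$ is the intersection of all ideals $I$ of $X$ such that $X/I$ is left nilpotent. Skew brace homomorphisms are maps that are homomorphisms for both group operations; an epimorphism is a surjective homomorphism. *)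

theory Defs
  imports "HOL-Algebra.Generated_Groups" "HOL-Algebra.AbelCoset"
begin

text \<open>
  Skew braces live on the library's two-operation record type: \<open>\<oplus>\<close> is the (not necessarily
  commutative) additive group, \<open>\<otimes>\<close> the multiplicative group. The brace axiom with \<open>a = \<one>\<close> and
  \<open>b = c = \<zero>\<close> forces \<open>\<one> = \<zero>\<close>.
\<close>

locale skew_brace =
  fixes X (structure)
  assumes add_group: "group (add_monoid X)"
    and mult_group: "group X"
    and brace_distrib:
      "\<lbrakk>a \<in> carrier X; b \<in> carrier X; c \<in> carrier X\<rbrakk>
        \<Longrightarrow> a \<otimes> (b \<oplus> c) = ((a \<otimes> b) \<ominus> a) \<oplus> (a \<otimes> c)"

definition brace_lambda :: "('a, 'm) ring_scheme \<Rightarrow> 'a \<Rightarrow> 'a \<Rightarrow> 'a"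
  where "brace_lambda X a b = (\<ominus>\<^bsub>X\<^esub> a) \<oplus>\<^bsub>X\<^esub> (a \<otimes>\<^bsub>X\<^esub> b)"

definition brace_star :: "('a, 'm) ring_scheme \<Rightarrow> 'a \<Rightarrow> 'a \<Rightarrow> 'a"
  where "brace_star X a b = brace_lambda X a b \<ominus>\<^bsub>X\<^esub> b"

definition brace_star_set :: "('a, 'm) ring_scheme \<Rightarrow> 'a set \<Rightarrow> 'a set \<Rightarrow> 'a set"
  where "brace_star_set X S T = generate (add_monoid X) {brace_star X s t | s t. s \<in> S \<and> t \<in> T}"

definition brace_ideal :: "'a set \<Rightarrow> ('a, 'm) ring_scheme \<Rightarrow> bool"
  where "brace_ideal I X \<longleftrightarrow>
    subgroup I (add_monoid X) \<and>
    (\<forall>a \<in> carrier X. \<forall>b \<in> I. brace_lambda X a b \<in> I) \<and>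
    I \<lhd> add_monoid X \<and> I \<lhd> X"

text \<open>
  For an ideal \<open>I\<close> the additive and multiplicative cosets coincide, since
  \<open>a \<otimes> i = a \<oplus> brace_lambda X a i\<close>, so the carrier consists of cosets for both operations.
\<close>

definition brace_quot :: "('a, 'm) ring_scheme \<Rightarrow> 'a set \<Rightarrow> 'a set ring"
  where "brace_quot X I =
    \<lparr>carrier = a_rcosets\<^bsub>X\<^esub> I, mult = set_mult X, one = I, zero = I, add = set_add X\<rparr>"

text \<open>The series starts at index 1; the value at 0 is a dummy.\<close>

fun left_series :: "('a, 'm) ring_scheme \<Rightarrow> nat \<Rightarrow> 'a set"
  where
    "left_series X 0 = carrier X"
  | "left_series X (Suc 0) = carrier X"
  | "left_series X (Suc (Suc n)) = brace_star_set X (carrier X) (left_series X (Suc n))"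

definition left_nilpotent :: "('a, 'm) ring_scheme \<Rightarrow> bool"
  where "left_nilpotent X \<longleftrightarrow> (\<exists>n\<ge>1. left_series X n = {\<zero>\<^bsub>X\<^esub>})"

definition L_infty :: "('a, 'm) ring_scheme \<Rightarrow> 'a set"
  where "L_infty X = (\<Inter>n\<in>{1..}. left_series X n)"

definition left_nilpotent_residual :: "('a, 'm) ring_scheme \<Rightarrow> 'a set"
  where "left_nilpotent_residual X =
    \<Inter> {I. brace_ideal I X \<and> left_nilpotent (brace_quot X I)}"

definition brace_hom :: "('a, 'm) ring_scheme \<Rightarrow> ('b, 'n) ring_scheme \<Rightarrow> ('a \<Rightarrow> 'b) set"
  where "brace_hom X Y = hom (add_monoid X) (add_monoid Y) \<inter> hom X Y"

definition brace_epi :: "('a, 'm) ring_scheme \<Rightarrow> ('b, 'n) ring_scheme \<Rightarrow> ('a \<Rightarrow> 'b) set"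
  where "brace_epi X Y = {f \<in> brace_hom X Y. f ` carrier X = carrier Y}"

definition brace_auto :: "('a, 'm) ring_scheme \<Rightarrow> ('a \<Rightarrow> 'a) set"
  where "brace_auto X = {f \<in> brace_hom X X. bij_betw f (carrier X) (carrier X)}"

end

theory Submission
  imports Defs
begin

text \<open>
  Everything rests on the equivalence, for a finite skew brace \<open>X\<close> and an ideal \<open>I\<close>, between
  left nilpotency of \<open>X/I\<close> and \<open>L_infty X \<subseteq> I\<close> (\<open>left_nilpotent_brace_quot_iff\<close>). It exhibits the
  residual as the least ideal containing \<open>L_infty X\<close>, which reduces the second equality to the first.

  An epimorphism \<open>f\<close> commutes with the star operation and with the generation of additive
  subgroups, so it maps each term of the left series of \<open>X\<close> onto the corresponding term of the
  series of \<open>Y\<close>. The left series is decreasing and therefore, by finiteness, eventually equal to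
  its intersection; evaluating at one large index in both braces gives
  \<open>f ` L_infty X = L_infty Y\<close> (\<open>image_L_infty\<close>). Applied to the canonical map onto \<open>X/I\<close>, this
  yields the equivalence above, as \<open>L_infty\<close> of \<open>X/I\<close>, the image of \<open>L_infty X\<close>, is trivial exactly
  when \<open>L_infty X \<subseteq> I\<close>.

  Images and preimages of ideals under an epimorphism are ideals. Hence
  \<open>f ` left_nilpotent_residual X\<close> is an ideal containing \<open>L_infty Y\<close>, and the preimage of
  \<open>left_nilpotent_residual Y\<close> is an ideal containing \<open>L_infty X\<close>; minimality on either side gives
  both inclusions of \<open>f ` left_nilpotent_residual X = left_nilpotent_residual Y\<close>. The statements
  on quotients and automorphisms are the instances of the canonical map and of \<open>X = Y\<close>.
\<close>

section \<open>Elementary facts on skew braces\<close>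

sublocale skew_brace \<subseteq> mult: group X
  by (rule mult_group)

sublocale skew_brace \<subseteq> add: group "add_monoid X"
  rewrites "carrier (add_monoid X) = carrier X"
    and "mult (add_monoid X) = add X"
    and "one (add_monoid X) = zero X"
    and "m_inv (add_monoid X) = a_inv X"
  by (rule add_group) (simp_all add: a_inv_def)

context skew_brace
begin

text \<open>
  Distributing \<open>\<one> \<otimes> (\<zero> \<oplus> \<zero>)\<close> leaves \<open>\<zero> = \<ominus> \<one>\<close>.
\<close>

lemma zero_eq_one: "\<zero> = \<one>"
proof -
  have "\<one> \<otimes> (\<zero> \<oplus> \<zero>) = ((\<one> \<otimes> \<zero>) \<ominus> \<one>) \<oplus> (\<one> \<otimes> \<zero>)"
    by (rule brace_distrib) auto
  then have "\<ominus> \<one> = \<zero>"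
    by (simp add: a_minus_def)
  then show ?thesis
    using add.inv_eq_1_iff[of \<one>] by simp
qed

lemma brace_lambda_closed [simp]:
  "a \<in> carrier X \<Longrightarrow> b \<in> carrier X \<Longrightarrow> brace_lambda X a b \<in> carrier X"
  by (simp add: brace_lambda_def)

lemma brace_star_closed [simp]:
  "a \<in> carrier X \<Longrightarrow> b \<in> carrier X \<Longrightarrow> brace_star X a b \<in> carrier X"
  by (simp add: brace_star_def a_minus_def)

lemma mult_eq_add_brace_lambda:
  "a \<in> carrier X \<Longrightarrow> b \<in> carrier X \<Longrightarrow> a \<otimes> b = a \<oplus> brace_lambda X a b"
  by (simp add: brace_lambda_def add.m_assoc[symmetric])

text \<open>
  Since \<open>\<one> = \<zero>\<close>, the brace axiom evaluates \<open>inv a \<otimes> (a \<oplus> b)\<close> to \<open>brace_lambda X (inv a) b\<close>.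
  Together with \<open>mult_eq_add_brace_lambda\<close>, this makes the additive and the multiplicative left
  cosets of a \<open>brace_lambda\<close>-invariant set equal.
\<close>

lemma add_eq_mult_brace_lambda_inv:
  assumes a: "a \<in> carrier X" and b: "b \<in> carrier X"
  shows "a \<oplus> b = a \<otimes> brace_lambda X (inv a) b"
proof -
  have "inv a \<otimes> (a \<oplus> b) = ((inv a \<otimes> a) \<ominus> inv a) \<oplus> (inv a \<otimes> b)"
    by (rule brace_distrib) (use a b in auto)
  also have "\<dots> = brace_lambda X (inv a) b"
    using a b by (simp add: a_minus_def brace_lambda_def zero_eq_one[symmetric])
  finally have "a \<otimes> (inv a \<otimes> (a \<oplus> b)) = a \<otimes> brace_lambda X (inv a) b"
    by simp
  then show ?thesis
    using a b by (simp add: mult.m_assoc[symmetric])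
qed

lemma brace_star_set_subset:
  assumes "S \<subseteq> carrier X" "T \<subseteq> carrier X"
  shows "brace_star_set X S T \<subseteq> carrier X"
  unfolding brace_star_set_def by (rule add.generate_incl) (use assms in \<open>auto simp: subset_iff\<close>)

lemma brace_star_set_mono:
  "T \<subseteq> T' \<Longrightarrow> brace_star_set X S T \<subseteq> brace_star_set X S T'"
  unfolding brace_star_set_def by (rule add.mono_generate) auto

lemma left_series_subset_carrier: "left_series X n \<subseteq> carrier X"
  by (induction n rule: induct_nat_012) (simp_all add: brace_star_set_subset)

end

lemma brace_idealI:
  assumes "skew_brace X" "subgroup I (add_monoid X)" "subgroup I X"
    and "\<And>a b. a \<in> carrier X \<Longrightarrow> b \<in> I \<Longrightarrow> brace_lambda X a b \<in> I"
    and "\<And>a b. a \<in> carrier X \<Longrightarrow> b \<in> I \<Longrightarrow> a \<oplus>\<^bsub>X\<^esub> b \<oplus>\<^bsub>X\<^esub> \<ominus>\<^bsub>X\<^esub> a \<in> I"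
    and "\<And>a b. a \<in> carrier X \<Longrightarrow> b \<in> I \<Longrightarrow> a \<otimes>\<^bsub>X\<^esub> b \<otimes>\<^bsub>X\<^esub> inv\<^bsub>X\<^esub> a \<in> I"
  shows "brace_ideal I X"
proof -
  interpret skew_brace X by fact
  show ?thesis
    unfolding brace_ideal_def add.normal_inv_iff mult.normal_inv_iff using assms by blast
qed

context
  fixes X (structure) and I
  assumes X: "skew_brace X" and I: "brace_ideal I X"
begin

interpretation skew_brace X by (rule X)

lemma brace_ideal_add_subgroup: "subgroup I (add_monoid X)"
  and brace_ideal_mult_subgroup: "subgroup I X"
  and brace_ideal_subset: "I \<subseteq> carrier X"
  and brace_ideal_zero: "\<zero> \<in> I"
  and brace_ideal_lambda: "a \<in> carrier X \<Longrightarrow> b \<in> I \<Longrightarrow> brace_lambda X a b \<in> I"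
  and brace_ideal_add_conj: "a \<in> carrier X \<Longrightarrow> b \<in> I \<Longrightarrow> a \<oplus> b \<oplus> \<ominus> a \<in> I"
  and brace_ideal_mult_conj: "a \<in> carrier X \<Longrightarrow> b \<in> I \<Longrightarrow> a \<otimes> b \<otimes> inv a \<in> I"
proof -
  show "subgroup I (add_monoid X)" "subgroup I X"
    using I by (auto simp: brace_ideal_def normal_imp_subgroup)
  then show "I \<subseteq> carrier X" "\<zero> \<in> I"
    using subgroup.subset[of I X] subgroup.one_closed[of I "add_monoid X"] by auto
  show "a \<in> carrier X \<Longrightarrow> b \<in> I \<Longrightarrow> brace_lambda X a b \<in> I"
    "a \<in> carrier X \<Longrightarrow> b \<in> I \<Longrightarrow> a \<oplus> b \<oplus> \<ominus> a \<in> I"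
    "a \<in> carrier X \<Longrightarrow> b \<in> I \<Longrightarrow> a \<otimes> b \<otimes> inv a \<in> I"
    using I unfolding brace_ideal_def add.normal_inv_iff mult.normal_inv_iff by auto
qed

text \<open>
  The comparison is made on left cosets, which \<open>brace_lambda\<close> relates directly; normality in
  each of the two groups carries it over to right cosets. This is what makes \<open>set_mult\<close> an
  operation on the additive cosets, which form the carrier of \<open>brace_quot\<close>.
\<close>

lemma add_r_coset_eq_mult_r_coset:
  assumes a: "a \<in> carrier X"
  shows "I +> a = I #> a"
proof -
  have "I +> a = a <+ I"
    using I a normal.coset_eq[of I "add_monoid X"]
    by (simp add: brace_ideal_def a_r_coset_def a_l_coset_def)
  also have "\<dots> = a <# I"
  proof (intro equalityI subsetI)
    fix x assume "x \<in> a <+ I"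
    then obtain i where "i \<in> I" "x = a \<oplus> i"
      by (auto simp: a_l_coset_def')
    then show "x \<in> a <# I"
      using a brace_ideal_subset brace_ideal_lambda[of "inv a" i]
      by (auto simp: l_coset_def add_eq_mult_brace_lambda_inv subset_iff)
  next
    fix x assume "x \<in> a <# I"
    then obtain i where "i \<in> I" "x = a \<otimes> i"
      by (auto simp: l_coset_def)
    then show "x \<in> a <+ I"
      using a brace_ideal_subset brace_ideal_lambda[of a i]
      by (auto simp: a_l_coset_def' mult_eq_add_brace_lambda subset_iff)
  qed
  also have "\<dots> = I #> a"
    using I a normal.coset_eq[of I X] by (simp add: brace_ideal_def)
  finally show ?thesis .
qed

end

lemma brace_ideal_carrier:
  assumes "skew_brace X"
  shows "brace_ideal (carrier X) X"
proof -
  interpret skew_brace X by fact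
  show ?thesis
    by (rule brace_idealI) (use assms add.subgroup_self mult.subgroup_self in auto)
qed

lemma brace_ideal_Inter:
  assumes X: "skew_brace X" and ne: "\<I> \<noteq> {}" and ideal: "\<And>I. I \<in> \<I> \<Longrightarrow> brace_ideal I X"
  shows "brace_ideal (\<Inter>\<I>) X"
proof -
  interpret skew_brace X by fact
  show ?thesis
  proof (rule brace_idealI[OF X])
    show "subgroup (\<Inter>\<I>) (add_monoid X)"
      by (rule add.subgroups_Inter) (use ne brace_ideal_add_subgroup[OF X ideal] in auto)
    show "subgroup (\<Inter>\<I>) X"
      by (rule mult.subgroups_Inter) (use ne brace_ideal_mult_subgroup[OF X ideal] in auto)
  qed (use brace_ideal_lambda[OF X ideal] brace_ideal_add_conj[OF X ideal]
        brace_ideal_mult_conj[OF X ideal] in auto)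
qed

section \<open>The left series of a finite skew brace\<close>

context skew_brace
begin

text \<open>
  The star operation is monotone in its second argument, so the inclusion of the second term in
  the first propagates along the recursion.
\<close>

lemma left_series_Suc_subset: "1 \<le> n \<Longrightarrow> left_series X (Suc n) \<subseteq> left_series X n"
proof (induction n rule: nat_induct_at_least)
  case base
  show ?case
    using left_series_subset_carrier[of "Suc 1"] by simp
next
  case (Suc n)
  then show ?case
    using brace_star_set_mono by (cases n) auto
qed

lemma left_series_antimono: "m \<le> n \<Longrightarrow> 1 \<le> m \<Longrightarrow> left_series X n \<subseteq> left_series X m"
proof (induction n rule: dec_induct)
  case (step n)
  then show ?case
    using left_series_Suc_subset[of n] by auto
qed simp

lemma zero_in_left_series: "\<zero> \<in> left_series X n"
  by (cases "(X, n)" rule: left_series.cases)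
    (use generate.one[of "add_monoid X"] in \<open>auto simp: brace_star_set_def\<close>)

lemma zero_in_L_infty: "\<zero> \<in> L_infty X"
  by (auto simp: L_infty_def zero_in_left_series)

text \<open>
  A term of least cardinality cannot properly contain a later one, so the series is constant
  from there on.
\<close>

lemma left_series_eventually_L_infty:
  assumes fin: "finite (carrier X)"
  obtains N where "1 \<le> N" "\<And>n. N \<le> n \<Longrightarrow> left_series X n = L_infty X"
proof -
  let ?card = "\<lambda>n. card (left_series X n)"
  obtain N where N: "1 \<le> N" and min: "\<And>n. 1 \<le> n \<Longrightarrow> ?card N \<le> ?card n"
    using ex_has_least_nat[of "\<lambda>n. 1 \<le> n" 1 ?card] by auto
  have const: "left_series X n = left_series X N" if "N \<le> n" for n
  proof (rule card_subset_eq)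
    show "finite (left_series X N)"
      using fin left_series_subset_carrier by (rule rev_finite_subset)
    show sub: "left_series X n \<subseteq> left_series X N"
      using that N by (rule left_series_antimono)
    show "?card n = ?card N"
      using min[of n] N that card_mono[OF \<open>finite (left_series X N)\<close> sub] by simp
  qed
  have "L_infty X = left_series X N"
  proof
    show "L_infty X \<subseteq> left_series X N"
      using N by (auto simp: L_infty_def)
    show "left_series X N \<subseteq> L_infty X"
      unfolding L_infty_def
    proof (rule INT_greatest)
      fix n :: nat assume "n \<in> {1..}"
      then have "left_series X (max N n) \<subseteq> left_series X n"
        by (intro left_series_antimono) auto
      then show "left_series X N \<subseteq> left_series X n"
        using const[of "max N n"] by simp
    qed
  qed
  with N const that show ?thesis
    by metis
qed

lemma L_infty_subset_carrier: "L_infty X \<subseteq> carrier X"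
  by (auto simp: L_infty_def)

lemma left_nilpotent_iff_L_infty:
  assumes "finite (carrier X)"
  shows "left_nilpotent X \<longleftrightarrow> L_infty X = {\<zero>}"
proof
  assume "left_nilpotent X"
  then obtain n where "1 \<le> n" "left_series X n = {\<zero>}"
    by (auto simp: left_nilpotent_def)
  then show "L_infty X = {\<zero>}"
    using zero_in_L_infty by (auto simp: L_infty_def)
next
  assume "L_infty X = {\<zero>}"
  with left_series_eventually_L_infty[OF assms] show "left_nilpotent X"
    unfolding left_nilpotent_def by (metis order_refl)
qed

end

section \<open>Epimorphisms\<close>

locale skew_brace_epi = X: skew_brace X + Y: skew_brace Y
  for X :: "('a, 'm) ring_scheme" and Y :: "('b, 'n) ring_scheme" +
  fixes f
  assumes epi: "f \<in> brace_epi X Y"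
begin

lemma image_carrier: "f ` carrier X = carrier Y"
  using epi by (simp add: brace_epi_def)

sublocale mult: group_hom X Y f
  using epi by unfold_locales (simp add: brace_epi_def brace_hom_def)

sublocale add: group_hom "add_monoid X" "add_monoid Y" f
  rewrites "carrier (add_monoid Z) = carrier Z"
    and "mult (add_monoid Z) = add Z"
    and "one (add_monoid Z) = zero Z"
    and "m_inv (add_monoid Z) = a_inv Z"
  using epi X.add_group Y.add_group
  by (auto simp: brace_epi_def brace_hom_def a_inv_def group_hom_def group_hom_axioms_def)

lemma map_lambda:
  "a \<in> carrier X \<Longrightarrow> b \<in> carrier X \<Longrightarrow> f (brace_lambda X a b) = brace_lambda Y (f a) (f b)"
  using add.hom_inv[of a] by (simp add: brace_lambda_def)

lemma map_star:
  "a \<in> carrier X \<Longrightarrow> b \<in> carrier X \<Longrightarrow> f (brace_star X a b) = brace_star Y (f a) (f b)"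
  by (simp add: brace_star_def a_minus_def map_lambda)

lemma image_brace_star_set:
  assumes "S \<subseteq> carrier X" "T \<subseteq> carrier X"
  shows "f ` brace_star_set X S T = brace_star_set Y (f ` S) (f ` T)"
proof -
  have "{brace_star Y s t |s t. s \<in> f ` S \<and> t \<in> f ` T} = f ` {brace_star X s t |s t. s \<in> S \<and> t \<in> T}"
    using assms by (force simp: map_star subset_iff image_iff)
  moreover have "{brace_star X s t |s t. s \<in> S \<and> t \<in> T} \<subseteq> carrier X"
    using assms by (auto simp: subset_iff)
  ultimately show ?thesis
    unfolding brace_star_set_def by (simp add: add.generate_img)
qed

lemma image_left_series: "f ` left_series X n = left_series Y n"
  by (induction n rule: induct_nat_012)
    (simp_all add: image_carrier image_brace_star_set X.left_series_subset_carrier)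

text \<open>
  Images do not commute with infinite intersections in general. Here both intersections are
  attained at a finite stage, and one index beyond both stages suffices.
\<close>

lemma image_L_infty:
  assumes fin: "finite (carrier X)"
  shows "f ` L_infty X = L_infty Y"
proof -
  have finY: "finite (carrier Y)"
    using fin image_carrier by (metis finite_imageI)
  obtain M where M: "\<And>n. M \<le> n \<Longrightarrow> left_series X n = L_infty X"
    using X.left_series_eventually_L_infty[OF fin] by blast
  obtain N where N: "\<And>n. N \<le> n \<Longrightarrow> left_series Y n = L_infty Y"
    using Y.left_series_eventually_L_infty[OF finY] by blast
  show ?thesis
    using image_left_series[of "max M N"] by (simp add: M N)
qed

text \<open>
  Surjectivity enters through the elements of \<open>Y\<close> acting by \<open>brace_lambda\<close> and by conjugation:
  they have to come from \<open>X\<close>.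
\<close>

lemma image_brace_ideal:
  assumes I: "brace_ideal I X"
  shows "brace_ideal (f ` I) Y"
proof (rule brace_idealI)
  note sub = brace_ideal_subset[OF X.skew_brace_axioms I]
  show "skew_brace Y"
    by (rule Y.skew_brace_axioms)
  show "subgroup (f ` I) (add_monoid Y)"
    by (rule add.subgroup_img_is_subgroup)
      (rule brace_ideal_add_subgroup[OF X.skew_brace_axioms I])
  show "subgroup (f ` I) Y"
    by (rule mult.subgroup_img_is_subgroup)
      (rule brace_ideal_mult_subgroup[OF X.skew_brace_axioms I])
  fix a b assume "a \<in> carrier Y" "b \<in> f ` I"
  then obtain x y where x: "x \<in> carrier X" "a = f x" and y: "y \<in> I" "b = f y"
    using image_carrier by (metis imageE)
  then have yX: "y \<in> carrier X"
    using sub by auto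
  show "brace_lambda Y a b \<in> f ` I"
    using x y yX brace_ideal_lambda[OF X.skew_brace_axioms I, of x y]
    by (auto simp: map_lambda[symmetric])
  have "a \<oplus>\<^bsub>Y\<^esub> b \<oplus>\<^bsub>Y\<^esub> \<ominus>\<^bsub>Y\<^esub> a = f (x \<oplus>\<^bsub>X\<^esub> y \<oplus>\<^bsub>X\<^esub> \<ominus>\<^bsub>X\<^esub> x)"
    using x y yX add.hom_inv[of x] by simp
  then show "a \<oplus>\<^bsub>Y\<^esub> b \<oplus>\<^bsub>Y\<^esub> \<ominus>\<^bsub>Y\<^esub> a \<in> f ` I"
    using x y brace_ideal_add_conj[OF X.skew_brace_axioms I] by auto
  have "a \<otimes>\<^bsub>Y\<^esub> b \<otimes>\<^bsub>Y\<^esub> inv\<^bsub>Y\<^esub> a = f (x \<otimes>\<^bsub>X\<^esub> y \<otimes>\<^bsub>X\<^esub> inv\<^bsub>X\<^esub> x)"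
    using x y yX by simp
  then show "a \<otimes>\<^bsub>Y\<^esub> b \<otimes>\<^bsub>Y\<^esub> inv\<^bsub>Y\<^esub> a \<in> f ` I"
    using x y brace_ideal_mult_conj[OF X.skew_brace_axioms I] by auto
qed

lemma vimage_brace_ideal:
  assumes J: "brace_ideal J Y"
  shows "brace_ideal {x \<in> carrier X. f x \<in> J} X"
proof (rule brace_idealI)
  interpret J_add: subgroup J "add_monoid Y"
    by (rule brace_ideal_add_subgroup[OF Y.skew_brace_axioms J])
  interpret J_mult: subgroup J Y
    by (rule brace_ideal_mult_subgroup[OF Y.skew_brace_axioms J])
  let ?I = "{x \<in> carrier X. f x \<in> J}"
  show "skew_brace X"
    by (rule X.skew_brace_axioms)
  show "subgroup ?I (add_monoid X)"
    using J_add.m_closed J_add.one_closed J_add.m_inv_closed add.hom_inv add.hom_one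
      X.add.inv_closed
    by unfold_locales (auto simp: a_inv_def)
  show "subgroup ?I X"
    by unfold_locales auto
  fix a b assume a: "a \<in> carrier X" and "b \<in> ?I"
  then have b: "b \<in> carrier X" "f b \<in> J"
    by auto
  have "f (a \<oplus>\<^bsub>X\<^esub> b \<oplus>\<^bsub>X\<^esub> \<ominus>\<^bsub>X\<^esub> a) = f a \<oplus>\<^bsub>Y\<^esub> f b \<oplus>\<^bsub>Y\<^esub> \<ominus>\<^bsub>Y\<^esub> f a"
    using a b add.hom_inv[of a] by simp
  then show "a \<oplus>\<^bsub>X\<^esub> b \<oplus>\<^bsub>X\<^esub> \<ominus>\<^bsub>X\<^esub> a \<in> ?I"
    using a b brace_ideal_add_conj[OF Y.skew_brace_axioms J, of "f a" "f b"] by simp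
  show "brace_lambda X a b \<in> ?I"
    using a b brace_ideal_lambda[OF Y.skew_brace_axioms J, of "f a" "f b"]
    by (simp add: map_lambda)
  show "a \<otimes>\<^bsub>X\<^esub> b \<otimes>\<^bsub>X\<^esub> inv\<^bsub>X\<^esub> a \<in> ?I"
    using a b brace_ideal_mult_conj[OF Y.skew_brace_axioms J, of "f a" "f b"] by simp
qed

end

section \<open>Quotients by ideals\<close>

context
  fixes X :: "('a, 'm) ring_scheme" (structure) and I
  assumes X: "skew_brace X" and I: "brace_ideal I X"
begin

interpretation skew_brace X by (rule X)

lemma brace_quot_proj_epi: "(\<lambda>a. I +> a) \<in> brace_epi X (brace_quot X I)"
proof -
  have "(\<lambda>a. I #>\<^bsub>add_monoid X\<^esub> a) \<in> hom (add_monoid X) (add_monoid X Mod I)"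
    by (rule normal.r_coset_hom_Mod) (use I in \<open>simp add: brace_ideal_def\<close>)
  then have add: "(\<lambda>a. I +> a) \<in> hom (add_monoid X) (add_monoid (brace_quot X I))"
    by (simp add: hom_def FactGroup_def brace_quot_def a_r_coset_def A_RCOSETS_def set_add_def)
  have "(\<lambda>a. I #> a) \<in> hom X (X Mod I)"
    by (rule normal.r_coset_hom_Mod) (use I in \<open>simp add: brace_ideal_def\<close>)
  then have "(I +> (a \<otimes> b)) = (I +> a) <#> (I +> b)" if "a \<in> carrier X" "b \<in> carrier X" for a b
    using that by (simp add: add_r_coset_eq_mult_r_coset[OF X I] hom_def)
  then have mult: "(\<lambda>a. I +> a) \<in> hom X (brace_quot X I)"
    using add by (auto simp: hom_def brace_quot_def)
  have "(\<lambda>a. I +> a) ` carrier X = carrier (brace_quot X I)"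
    by (auto simp: brace_quot_def A_RCOSETS_def')
  with add mult show ?thesis
    by (simp add: brace_epi_def brace_hom_def)
qed

lemma a_r_coset_eq_ideal_iff:
  assumes "a \<in> carrier X"
  shows "I +> a = I \<longleftrightarrow> a \<in> I"
  using add.rcos_self[of a I] add.coset_join2[of a I] assms brace_ideal_add_subgroup[OF X I]
  by (auto simp: a_r_coset_def)

text \<open>
  All axioms are inherited along the canonical map, a surjection preserving both operations.
\<close>

lemma skew_brace_brace_quot: "skew_brace (brace_quot X I)"
proof -
  let ?Q = "brace_quot X I" and ?p = "\<lambda>a. I +> a"
  have add: "?p \<in> hom (add_monoid X) (add_monoid ?Q)" and mult: "?p \<in> hom X ?Q"
    and onto: "?p ` carrier X = carrier ?Q"
    using brace_quot_proj_epi by (auto simp: brace_epi_def brace_hom_def)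
  have zero: "?p \<zero> = I"
    using brace_ideal_zero[OF X I] by (simp add: a_r_coset_eq_ideal_iff)
  have group_add: "group (add_monoid ?Q)"
    using add.hom_imp_img_group[OF add] onto zero by (simp add: brace_quot_def)
  have group_mult: "group ?Q"
    using mult.hom_imp_img_group[OF mult] onto zero
    by (simp add: brace_quot_def zero_eq_one)
  interpret p: group_hom "add_monoid X" "add_monoid ?Q" ?p
    using add group_add add_group by (simp add: group_hom_def group_hom_axioms_def)
  show ?thesis
  proof (rule skew_brace.intro)
    fix a b c assume "a \<in> carrier ?Q" "b \<in> carrier ?Q" "c \<in> carrier ?Q"
    then obtain x y z where x: "x \<in> carrier X" "a = ?p x"
      and y: "y \<in> carrier X" "b = ?p y" and z: "z \<in> carrier X" "c = ?p z"
      using onto by (metis (no_types, lifting) imageE)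
    have "?p (x \<otimes> (y \<oplus> z)) = ?p (((x \<otimes> y) \<oplus> \<ominus> x) \<oplus> (x \<otimes> z))"
      using x y z by (simp add: brace_distrib a_minus_def)
    moreover have "?p (\<ominus> x) = \<ominus>\<^bsub>?Q\<^esub> ?p x"
      using x p.hom_inv[of x] by (simp add: a_inv_def)
    ultimately show "a \<otimes>\<^bsub>?Q\<^esub> (b \<oplus>\<^bsub>?Q\<^esub> c) = ((a \<otimes>\<^bsub>?Q\<^esub> b) \<ominus>\<^bsub>?Q\<^esub> a) \<oplus>\<^bsub>?Q\<^esub> (a \<otimes>\<^bsub>?Q\<^esub> c)"
      using x y z hom_mult[OF add] hom_mult[OF mult] by (simp add: a_minus_def)
  qed (rule group_add group_mult)+
qed

lemma skew_brace_epi_brace_quot: "skew_brace_epi X (brace_quot X I) (\<lambda>a. I +> a)"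
  by (intro skew_brace_epi.intro skew_brace_epi_axioms.intro X skew_brace_brace_quot
      brace_quot_proj_epi)

lemma finite_brace_quot: "finite (carrier X) \<Longrightarrow> finite (carrier (brace_quot X I))"
  by (simp add: brace_quot_def A_RCOSETS_def')

text \<open>
  Left nilpotency of the finite brace \<open>X/I\<close> means that \<open>L_infty\<close> of it is trivial, and this set
  is the image of \<open>L_infty X\<close>, whose elements become trivial exactly if they lie in \<open>I\<close>.
\<close>

lemma left_nilpotent_brace_quot_iff:
  assumes "finite (carrier X)"
  shows "left_nilpotent (brace_quot X I) \<longleftrightarrow> L_infty X \<subseteq> I"
proof -
  interpret p: skew_brace_epi X "brace_quot X I" "\<lambda>a. I +> a"
    by (rule skew_brace_epi_brace_quot)
  have "left_nilpotent (brace_quot X I) \<longleftrightarrow> (\<lambda>a. I +> a) ` L_infty X = {I}"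
    using p.Y.left_nilpotent_iff_L_infty[OF finite_brace_quot[OF assms]]
    by (simp add: p.image_L_infty[OF assms] brace_quot_def)
  also have "\<dots> \<longleftrightarrow> (\<forall>a \<in> L_infty X. I +> a = I)"
    using zero_in_L_infty by blast
  also have "\<dots> \<longleftrightarrow> L_infty X \<subseteq> I"
    using L_infty_subset_carrier by (auto simp: a_r_coset_eq_ideal_iff subset_iff)
  finally show ?thesis .
qed

end

section \<open>The left-nilpotent residual\<close>

context skew_brace
begin

lemma left_nilpotent_residual_eq:
  assumes "finite (carrier X)"
  shows "left_nilpotent_residual X = \<Inter>{I. brace_ideal I X \<and> L_infty X \<subseteq> I}"
  unfolding left_nilpotent_residual_def
  using left_nilpotent_brace_quot_iff[OF skew_brace_axioms _ assms]
  by (metis (no_types, lifting))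

text \<open>
  The family being intersected is nonempty, as it contains the carrier; otherwise the
  intersection would be the whole type.
\<close>

lemma brace_ideal_left_nilpotent_residual:
  assumes "finite (carrier X)"
  shows "brace_ideal (left_nilpotent_residual X) X"
  unfolding left_nilpotent_residual_eq[OF assms]
  by (rule brace_ideal_Inter[OF skew_brace_axioms])
    (use brace_ideal_carrier[OF skew_brace_axioms] L_infty_subset_carrier in blast)+

lemma L_infty_subset_residual:
  assumes "finite (carrier X)"
  shows "L_infty X \<subseteq> left_nilpotent_residual X"
  unfolding left_nilpotent_residual_eq[OF assms] by blast

lemma left_nilpotent_residual_least:
  assumes "finite (carrier X)" "brace_ideal I X" "L_infty X \<subseteq> I"
  shows "left_nilpotent_residual X \<subseteq> I"
  unfolding left_nilpotent_residual_eq[OF assms(1)] using assms(2,3) by blast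

end

text \<open>
  Each inclusion is the minimality of one residual, tested against the preimage or the image of
  the other.
\<close>

lemma (in skew_brace_epi) image_left_nilpotent_residual:
  assumes fin: "finite (carrier X)"
  shows "f ` left_nilpotent_residual X = left_nilpotent_residual Y"
proof
  have finY: "finite (carrier Y)"
    using fin image_carrier by (metis finite_imageI)
  have "left_nilpotent_residual X \<subseteq> {x \<in> carrier X. f x \<in> left_nilpotent_residual Y}"
  proof (rule X.left_nilpotent_residual_least[OF fin])
    show "brace_ideal {x \<in> carrier X. f x \<in> left_nilpotent_residual Y} X"
      by (intro vimage_brace_ideal Y.brace_ideal_left_nilpotent_residual finY)
    show "L_infty X \<subseteq> {x \<in> carrier X. f x \<in> left_nilpotent_residual Y}"
      using X.L_infty_subset_carrier Y.L_infty_subset_residual[OF finY] image_L_infty[OF fin]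
      by blast
  qed
  then show "f ` left_nilpotent_residual X \<subseteq> left_nilpotent_residual Y"
    by blast
  show "left_nilpotent_residual Y \<subseteq> f ` left_nilpotent_residual X"
  proof (rule Y.left_nilpotent_residual_least[OF finY])
    show "brace_ideal (f ` left_nilpotent_residual X) Y"
      by (intro image_brace_ideal X.brace_ideal_left_nilpotent_residual fin)
    show "L_infty Y \<subseteq> f ` left_nilpotent_residual X"
      using X.L_infty_subset_residual[OF fin] image_L_infty[OF fin] by blast
  qed
qed

text \<open>
  The right-hand side of the quotient formula, \<open>(R + I)/I\<close>, is the image of \<open>R\<close> under the
  canonical map, since summands from \<open>I\<close> do not change a coset.
\<close>

lemma a_rcosets_set_add_ideal:
  assumes X: "skew_brace X" and I: "brace_ideal I X" and R: "R \<subseteq> carrier X"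
  shows "a_rcosets\<^bsub>X\<lparr>carrier := R <+>\<^bsub>X\<^esub> I\<rparr>\<^esub> I = (\<lambda>a. I +>\<^bsub>X\<^esub> a) ` R"
proof -
  interpret p: skew_brace_epi X "brace_quot X I" "\<lambda>a. I +>\<^bsub>X\<^esub> a"
    by (rule skew_brace_epi_brace_quot[OF X I])
  have absorb: "I +>\<^bsub>X\<^esub> (r \<oplus>\<^bsub>X\<^esub> i) = I +>\<^bsub>X\<^esub> r" if "r \<in> R" "i \<in> I" for r i
  proof -
    have r: "r \<in> carrier X" and i: "i \<in> carrier X"
      using that R brace_ideal_subset[OF X I] by auto
    have "I +>\<^bsub>X\<^esub> i = \<zero>\<^bsub>brace_quot X I\<^esub>"
      using that i a_r_coset_eq_ideal_iff[OF X I] by (simp add: brace_quot_def)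
    then show ?thesis
      using r i p.add.hom_mult[of r i] p.add.hom_closed[of r] by simp
  qed
  have "a_rcosets\<^bsub>X\<lparr>carrier := R <+>\<^bsub>X\<^esub> I\<rparr>\<^esub> I = (\<Union>a\<in>R <+>\<^bsub>X\<^esub> I. {I +>\<^bsub>X\<^esub> a})"
    by (simp add: A_RCOSETS_def' a_r_coset_def')
  also have "\<dots> = (\<Union>r\<in>R. \<Union>i\<in>I. {I +>\<^bsub>X\<^esub> (r \<oplus>\<^bsub>X\<^esub> i)})"
    by (auto simp: set_add_def set_mult_def)
  also have "\<dots> = (\<lambda>a. I +>\<^bsub>X\<^esub> a) ` R"
    using absorb brace_ideal_zero[OF X I] by auto
  finally show ?thesis .
qed

theorem proposition5p5:
  fixes X :: "('a, 'm) ring_scheme"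
  assumes "skew_brace X" and "finite (carrier X)"
  shows
    "(\<forall>(Y :: ('b, 'n) ring_scheme) f.
        skew_brace Y \<longrightarrow> finite (carrier Y) \<longrightarrow> f \<in> brace_epi X Y \<longrightarrow>
          f ` L_infty X = L_infty Y \<and>
          f ` left_nilpotent_residual X = left_nilpotent_residual Y) \<and>
     (\<forall>I. brace_ideal I X \<longrightarrow>
        left_nilpotent_residual (brace_quot X I) =
          a_rcosets\<^bsub>X\<lparr>carrier := left_nilpotent_residual X <+>\<^bsub>X\<^esub> I\<rparr>\<^esub> I) \<and>
     (\<forall>\<phi> \<in> brace_auto X.
        \<phi> ` L_infty X = L_infty X \<and>
        \<phi> ` left_nilpotent_residual X = left_nilpotent_residual X)"
proof (intro conjI allI impI ballI)
  note X = \<open>skew_brace X\<close> and fin = \<open>finite (carrier X)\<close>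
  note img = skew_brace_epi.image_L_infty[OF _ fin]
    skew_brace_epi.image_left_nilpotent_residual[OF _ fin]
  {
    fix Y :: "('b, 'n) ring_scheme" and f
    assume "skew_brace Y" "f \<in> brace_epi X Y"
    then have "skew_brace_epi X Y f"
      using X by (simp add: skew_brace_epi_def skew_brace_epi_axioms_def)
    then show "f ` L_infty X = L_infty Y"
      "f ` left_nilpotent_residual X = left_nilpotent_residual Y"
      by (rule img)+
  next
    fix I assume I: "brace_ideal I X"
    have "left_nilpotent_residual X \<subseteq> carrier X"
      using skew_brace.brace_ideal_left_nilpotent_residual[OF X fin]
      by (rule brace_ideal_subset[OF X])
    then show "left_nilpotent_residual (brace_quot X I) =
        a_rcosets\<^bsub>X\<lparr>carrier := left_nilpotent_residual X <+>\<^bsub>X\<^esub> I\<rparr>\<^esub> I"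
      using img(2)[OF skew_brace_epi_brace_quot[OF X I]]
      by (simp add: a_rcosets_set_add_ideal[OF X I])
  next
    fix \<phi> assume "\<phi> \<in> brace_auto X"
    then have "skew_brace_epi X X \<phi>"
      using X by (simp add: skew_brace_epi_def skew_brace_epi_axioms_def brace_auto_def
          brace_epi_def bij_betw_def)
    then show "\<phi> ` L_infty X = L_infty X"
      "\<phi> ` left_nilpotent_residual X = left_nilpotent_residual X"
      by (rule img)+
  }
qed

end
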